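(* Let $G\cong\mathbb{Z}_{\ell_1}\times\cdots\times\mathbb{Z}_{\ell_r}$ be a finite abelian group with exponent $\ell^*$, let $I$ be a finite multiset with elements from $G$, let $K\le\mathbb{Z}_{\ell^*}^\times$ be a subgroup of the group of all multipliers of $I$, and let $\sigma=\sum_{i\in I} i$. If $\gcd(|I|,\ell^* )=1$, then $$I-|I|^{\phi(\ell^* )-1}\sigma=\alpha_1 s_1K\cup\alpha_2 s_2K\cup\cdots\cup\alpha_m s_mK$$ for some $s_1,\ldots,s_m\in G$ and $\alpha_1,\ldots,\alpha_m\in\mathbb{Z}_{\ge0}$, where the union is disjoint.
   Context: A multiset $I$ with elements from $G$ assigns a multiplicity $\mathrm{m}_I(g)\in\mathbb{Z}_{\ge0}$ to each $g\in G$; $|I|=\sum_g \mathrm{m}_I(g)$, and $\sigma=\sum_{i\in I}i=\sum_g \mathrm{m}_I(g)\,g$. For $g\in G$, $I+g$ is the multiset with $\mathrm{m}_{I+g}(x+g)=\mathrm{m}_I(x)$; for $t\in\mathbb{Z}_{\ell^*}^\times$, $tI$ is the multiset $\{(ti)^{\mathrm{m}_I(i)}\}$. An element $t\in\mathbb{Z}_{\ell^*}^\times$ is a multiplier of $I$ if $tI=I+g$ for some $g\in G$; the multipliers form a subgroup of $\mathbb{Z}_{\ell^*}^\times$ (written multiplicatively). $\phi$ is Euler's totient function. For $s\in G$ and $K\le\mathbb{Z}_{\ell^*}^\times$, $sK=\{st: t\in K\}$ is the $K$-orbit of $s$, and $\alpha sK$ denotes the multiset in which each element of $sK$ has multiplicity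 $\alpha$; the union of such multisets over pairwise disjoint orbits $s_iK$ is the multiset whose multiplicity function is the sum of theirs. *)

theory Defs
  imports "HOL-Algebra.Algebra" "HOL-Number_Theory.Number_Theory"
    "HOL-Library.Multiset" "HOL-Library.Disjoint_Sets"
begin

text \<open>
  Abelian groups are written multiplicatively, as usual in HOL-Algebra: \<open>x [^]\<^bsub>G\<^esub> t\<close> is the
  scalar multiple \<open>t x\<close> of the additive notation, and \<open>\<otimes>\<close>, \<open>inv\<close> are its sum and negation.
\<close>

definition group_exponent :: "('a, 'b) monoid_scheme \<Rightarrow> nat" where
  "group_exponent G = (LEAST n. 0 < n \<and> (\<forall>x\<in>carrier G. x [^]\<^bsub>G\<^esub> n = \<one>\<^bsub>G\<^esub>))"

text \<open>
  The unit of \<open>residue_ring 1\<close> is \<open>1\<close>, which is not in its carrier \<open>{0}\<close>, so that this ring has no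
  units. Reducing the unit modulo \<open>n\<close> changes nothing for \<open>n \<ge> 2\<close> and makes the unit group
  for \<open>n = 1\<close> the trivial group, as needed for a group of exponent \<open>1\<close>.
\<close>

definition Zmod_units :: "nat \<Rightarrow> int monoid" where
  "Zmod_units n = units_of (residue_ring (int n) \<lparr>one := 1 mod int n\<rparr>)"

definition mset_sum :: "('a, 'b) monoid_scheme \<Rightarrow> 'a multiset \<Rightarrow> 'a" where
  "mset_sum G I = (\<Otimes>\<^bsub>G\<^esub>x\<in>carrier G. x [^]\<^bsub>G\<^esub> count I x)"

definition translate :: "('a, 'b) monoid_scheme \<Rightarrow> 'a multiset \<Rightarrow> 'a \<Rightarrow> 'a multiset" where
  "translate G I g = image_mset (\<lambda>x. x \<otimes>\<^bsub>G\<^esub> g) I"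

definition dilate :: "('a, 'b) monoid_scheme \<Rightarrow> int \<Rightarrow> 'a multiset \<Rightarrow> 'a multiset" where
  "dilate G t I = image_mset (\<lambda>x. x [^]\<^bsub>G\<^esub> t) I"

definition multipliers :: "('a, 'b) monoid_scheme \<Rightarrow> 'a multiset \<Rightarrow> int set" where
  "multipliers G I =
     {t \<in> carrier (Zmod_units (group_exponent G)). \<exists>g\<in>carrier G. dilate G t I = translate G I g}"

definition unit_orbit :: "('a, 'b) monoid_scheme \<Rightarrow> 'a \<Rightarrow> int set \<Rightarrow> 'a set" where
  "unit_orbit G s K = (\<lambda>t. s [^]\<^bsub>G\<^esub> t) ` K"

end

theory Submission
  imports Defs
begin

text \<open>
  Additively: since \<open>|I|\<close> is invertible modulo the exponent, with inverse
  \<open>c = |I| ^ (\<phi> - 1)\<close>, the translate \<open>J = I - c\<sigma>\<close> has sum \<open>0\<close>. A multiplier \<open>t\<close> of \<open>I\<close> satisfies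
  \<open>tJ = J + h\<close> for some \<open>h\<close>, and comparing sums gives \<open>|I| h = 0\<close>, hence \<open>h = 0\<close>. So \<open>J\<close> is fixed by
  every \<open>t \<in> K\<close>, its multiplicity function is constant on \<open>K\<close>-orbits, and the orbits partition \<open>G\<close>.
\<close>

section \<open>The unit group modulo n\<close>

text \<open>For \<open>n = 1\<close> the reduced unit is 0, which does lie in the carrier, so the
  monoid laws hold for every positive \<open>n\<close>.\<close>

lemma monoid_residue_ring_one_mod:
  assumes "0 < n"
  shows "monoid (residue_ring (int n) \<lparr>one := 1 mod int n\<rparr>)"
proof -
  have "0 \<le> x mod int n \<and> x mod int n \<le> int n - 1" for x
    using assms by (simp add: zle_diff1_eq)
  then show ?thesis
    by unfold_locales (auto simp: residue_ring_def mod_simps mult.assoc)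
qed

lemma group_Zmod_units: "0 < n \<Longrightarrow> group (Zmod_units n)"
  unfolding Zmod_units_def by (rule monoid.units_group[OF monoid_residue_ring_one_mod])

lemma mult_Zmod_units: "x \<otimes>\<^bsub>Zmod_units n\<^esub> y = x * y mod int n"
  by (simp add: Zmod_units_def units_of_def residue_ring_def)

lemma one_Zmod_units: "\<one>\<^bsub>Zmod_units n\<^esub> = 1 mod int n"
  by (simp add: Zmod_units_def units_of_def)

section \<open>The exponent of a finite group\<close>

lemma (in group) group_exponent:
  assumes "finite (carrier G)"
  shows group_exponent_pos: "0 < group_exponent G"
    and pow_group_exponent: "\<And>x. x \<in> carrier G \<Longrightarrow> x [^] group_exponent G = \<one>"
proof -
  \<comment> \<open>The group order is a witness, so the \<open>LEAST\<close> is attained and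
    satisfies both conditions.\<close>
  have "0 < order G \<and> (\<forall>x\<in>carrier G. x [^] order G = \<one>)"
    using assms by (auto simp: order_gt_0_iff_finite pow_order_eq_1)
  from LeastI[where P = "\<lambda>n. 0 < n \<and> (\<forall>x\<in>carrier G. x [^] n = \<one>)", OF this]
  show "0 < group_exponent G" "\<And>x. x \<in> carrier G \<Longrightarrow> x [^] group_exponent G = \<one>"
    unfolding group_exponent_def by auto
qed

text \<open>Makes residues modulo the exponent act on the group, so products reduced in
  \<open>Zmod_units\<close> can be used as exponents.\<close>

lemma (in group) int_pow_mod_exponent:
  assumes "finite (carrier G)" "x \<in> carrier G"
  shows "x [^] (t mod int (group_exponent G)) = x [^] (t::int)"
proof -
  let ?n = "int (group_exponent G)"
  have n: "x [^] ?n = \<one>"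
    using pow_group_exponent[OF assms] by (simp add: int_pow_int)
  have "x [^] t = x [^] (?n * (t div ?n) + t mod ?n)"
    by simp
  also have "\<dots> = (x [^] ?n) [^] (t div ?n) \<otimes> x [^] (t mod ?n)"
    using assms by (simp only: int_pow_mult int_pow_pow)
  finally show ?thesis
    using n assms by simp
qed

text \<open>By Euler's theorem \<open>k ^ (totient n - 1)\<close> inverts \<open>k\<close> modulo
  the exponent \<open>n\<close>.\<close>

lemma (in group) pow_coprime_totient:
  assumes "finite (carrier G)" "x \<in> carrier G" "coprime k (group_exponent G)"
  shows "x [^] (k * k ^ (totient (group_exponent G) - 1)) = x"
proof -
  let ?n = "group_exponent G"
  \<comment> \<open>Ensures that the natural-number subtraction in \<open>totient ?n - 1\<close>
    does not truncate.\<close>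
  have "0 < totient ?n"
    using group_exponent_pos[OF assms(1)] by simp
  then have k: "k * k ^ (totient ?n - 1) = k ^ totient ?n"
    by (simp flip: power_Suc)
  have "[k ^ totient ?n = 1] (mod ?n)"
    using assms(3) by (rule euler_theorem)
  then have "int (k ^ totient ?n) mod int ?n = 1 mod int ?n"
    by (metis cong_def of_nat_1 of_nat_mod)
  then have "x [^] int (k ^ totient ?n) = x [^] (1::int)"
    using int_pow_mod_exponent[OF assms(1,2)] by metis
  then show ?thesis
    using assms(2) unfolding k int_pow_int by (simp add: int_pow_1)
qed

section \<open>Sums of multisets\<close>

context comm_group
begin

lemma mset_sum_empty [simp]: "mset_sum G {#} = \<one>"
  unfolding mset_sum_def by simp

lemma mset_sum_closed [simp]: "mset_sum G I \<in> carrier G"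
  unfolding mset_sum_def by (intro finprod_closed) auto

lemma mset_sum_add_mset:
  assumes "finite (carrier G)" "x \<in> carrier G"
  shows "mset_sum G (add_mset x I) = x \<otimes> mset_sum G I"
proof -
  \<comment> \<open>The additional copy of \<open>x\<close> is split off as a factor that is trivial
    away from \<open>x\<close>.\<close>
  have "mset_sum G (add_mset x I)
      = (\<Otimes>y\<in>carrier G. (if x = y then x else \<one>) \<otimes> y [^] count I y)"
    unfolding mset_sum_def
    by (intro finprod_cong') (auto simp: assms(2) m_comm)
  also have "\<dots> = (\<Otimes>y\<in>carrier G. if x = y then x else \<one>) \<otimes> mset_sum G I"
    unfolding mset_sum_def using assms by (subst finprod_multf) auto
  also have "(\<Otimes>y\<in>carrier G. if x = y then x else \<one>) = x"
    using finprod_singleton[of x "carrier G" "\<lambda>_. x"] assms by auto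
  finally show ?thesis .
qed

lemma mset_sum_translate:
  assumes "finite (carrier G)" "g \<in> carrier G" "set_mset I \<subseteq> carrier G"
  shows "mset_sum G (translate G I g) = mset_sum G I \<otimes> g [^] size I"
  using assms(3)
proof (induction I)
  case (add x I)
  then show ?case
    using assms(1,2) by (simp add: translate_def mset_sum_add_mset m_ac)
qed (simp add: translate_def)

lemma mset_sum_dilate:
  fixes t :: int
  assumes "finite (carrier G)" "set_mset I \<subseteq> carrier G"
  shows "mset_sum G (dilate G t I) = mset_sum G I [^] t"
  using assms(2)
proof (induction I)
  case (add x I)
  then show ?case
    using assms(1) by (simp add: dilate_def mset_sum_add_mset int_pow_distrib)
qed (simp add: dilate_def)

lemma translate_translate:
  assumes "set_mset I \<subseteq> carrier G" "g \<in> carrier G" "h \<in> carrier G"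
  shows "translate G (translate G I g) h = translate G I (g \<otimes> h)"
  using assms unfolding translate_def multiset.map_comp
  by (intro image_mset_cong) (auto simp: m_assoc)

lemma dilate_translate:
  fixes t :: int
  assumes "set_mset I \<subseteq> carrier G" "g \<in> carrier G"
  shows "dilate G t (translate G I g) = translate G (dilate G t I) (g [^] t)"
  using assms unfolding translate_def dilate_def multiset.map_comp
  by (intro image_mset_cong) (auto simp: int_pow_distrib)

lemma translate_one: "set_mset I \<subseteq> carrier G \<Longrightarrow> translate G I \<one> = I"
  unfolding translate_def by (induction I) auto

lemma set_mset_translate:
  "set_mset I \<subseteq> carrier G \<Longrightarrow> g \<in> carrier G \<Longrightarrow> set_mset (translate G I g) \<subseteq> carrier G"
  unfolding translate_def by auto

section \<open>The zero-sum translate is fixed by multipliers\<close>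

text \<open>The shift contributes its \<open>size I\<close>-th power, which is the inverse of the
  sum of \<open>I\<close> by \<open>pow_coprime_totient\<close>.\<close>

lemma mset_sum_centered:
  assumes "finite (carrier G)" "set_mset I \<subseteq> carrier G" "coprime (size I) (group_exponent G)"
  shows "mset_sum G (translate G I
    (inv (mset_sum G I [^] (size I ^ (totient (group_exponent G) - 1))))) = \<one>"
  using assms pow_coprime_totient[OF assms(1) _ assms(3), of "mset_sum G I"]
  by (simp add: mset_sum_translate nat_pow_inv nat_pow_pow mult.commute)

lemma dilate_eq_translate_imp_fixed:
  fixes t :: int
  assumes "finite (carrier G)" "set_mset J \<subseteq> carrier G" "coprime (size J) (group_exponent G)"
    and "mset_sum G J = \<one>" "h \<in> carrier G" "dilate G t J = translate G J h"
  shows "dilate G t J = J"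
proof -
  have "\<one> = mset_sum G (translate G J h)"
    using mset_sum_dilate[OF assms(1,2), of t] assms(4,6) by simp
  then have "h [^] size J = \<one>"
    using assms by (simp add: mset_sum_translate)
  \<comment> \<open>Raising to the inverse of \<open>size J\<close> modulo the exponent recovers
    \<open>h\<close> on the left.\<close>
  then have "h [^] (size J * size J ^ (totient (group_exponent G) - 1)) = \<one>"
    using assms(5) by (simp flip: nat_pow_pow)
  then have "h = \<one>"
    using pow_coprime_totient[OF assms(1,5,3)] by simp
  then show ?thesis
    using assms(2,6) by (simp add: translate_one)
qed

text \<open>Being a multiplier survives translation: additively, t(I + g) = I + h + tg = (I + g) +
  (h + tg - g).\<close>

lemma dilate_translate_eq_translate:
  fixes t :: int
  assumes "set_mset I \<subseteq> carrier G" "g \<in> carrier G" "h \<in> carrier G"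
    and "dilate G t I = translate G I h"
  shows "dilate G t (translate G I g) = translate G (translate G I g) (inv g \<otimes> h \<otimes> g [^] t)"
proof -
  have "g \<otimes> (inv g \<otimes> h \<otimes> g [^] t) = h \<otimes> g [^] t"
    using assms(2,3) by (simp add: m_assoc[symmetric])
  then show ?thesis
    using assms by (simp add: dilate_translate translate_translate)
qed

section \<open>Orbits of unit groups\<close>

context
  fixes K :: "int set"
  assumes fin: "finite (carrier G)"
    and K: "subgroup K (Zmod_units (group_exponent G))"
begin

lemma unit_orbit_self: "s \<in> carrier G \<Longrightarrow> s \<in> unit_orbit G s K"
proof -
  assume s: "s \<in> carrier G"
  have "1 mod int (group_exponent G) \<in> K"
    using subgroup.one_closed[OF K] by (simp add: one_Zmod_units)
  \<comment> \<open>If the exponent is 1, this power is the zeroth one, and the equation holds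
    because the group is trivial.\<close>
  moreover have "s [^] (1 mod int (group_exponent G)) = s"
    using int_pow_mod_exponent[OF fin s, of 1] s by (simp add: int_pow_1)
  ultimately show ?thesis
    unfolding unit_orbit_def by force
qed

lemma unit_orbit_carrier: "s \<in> carrier G \<Longrightarrow> unit_orbit G s K \<subseteq> carrier G"
  unfolding unit_orbit_def by auto

lemma unit_orbit_subset:
  assumes s: "s \<in> carrier G" and x: "x \<in> unit_orbit G s K"
  shows "unit_orbit G x K \<subseteq> unit_orbit G s K"
proof
  fix y assume "y \<in> unit_orbit G x K"
  then obtain t u where t: "t \<in> K" "x = s [^] t" and u: "u \<in> K" "y = x [^] u"
    using x unfolding unit_orbit_def by auto
  have "t * u mod int (group_exponent G) \<in> K"
    using subgroup.m_closed[OF K t(1) u(1)] by (simp add: mult_Zmod_units)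
  moreover have "y = s [^] (t * u mod int (group_exponent G))"
    using s t u by (simp add: int_pow_pow int_pow_mod_exponent[OF fin])
  ultimately show "y \<in> unit_orbit G s K"
    unfolding unit_orbit_def by blast
qed

text \<open>The inverse of \<open>t\<close> in \<open>K\<close> undoes raising to the power
  \<open>t\<close>. This gives both the symmetry of orbits and the injectivity of the power
  map.\<close>

lemma Zmod_units_inverse:
  assumes "t \<in> K"
  shows "\<exists>u\<in>K. \<forall>s\<in>carrier G. (s [^] t) [^] u = s"
proof -
  let ?Z = "Zmod_units (group_exponent G)"
  interpret Z: group ?Z
    using group_exponent_pos[OF fin] by (rule group_Zmod_units)
  have inv: "inv\<^bsub>?Z\<^esub> t \<in> K"
    using subgroup.m_inv_closed[OF K assms] .
  have "t * inv\<^bsub>?Z\<^esub> t mod int (group_exponent G) = 1 mod int (group_exponent G)"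
    using Z.r_inv[OF subgroup.mem_carrier[OF K assms]]
    by (simp add: mult_Zmod_units one_Zmod_units)
  then have "(s [^] t) [^] inv\<^bsub>?Z\<^esub> t = s" if "s \<in> carrier G" for s
    using that int_pow_mod_exponent[OF fin that, of "t * inv\<^bsub>?Z\<^esub> t"]
      int_pow_mod_exponent[OF fin that, of 1]
    by (simp add: int_pow_pow int_pow_1)
  with inv show ?thesis by blast
qed

text \<open>The inverse in \<open>K\<close> leads back from \<open>x\<close> to \<open>s\<close>, so
  each orbit contains the other. Hence distinct orbits are disjoint.\<close>

lemma unit_orbit_eq:
  assumes s: "s \<in> carrier G" and x: "x \<in> unit_orbit G s K"
  shows "unit_orbit G x K = unit_orbit G s K"
proof -
  obtain t where t: "t \<in> K" "x = s [^] t"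
    using x unfolding unit_orbit_def by auto
  obtain u where "u \<in> K" "x [^] u = s"
    using Zmod_units_inverse[OF t(1)] s t(2) by metis
  then have "s \<in> unit_orbit G x K"
    unfolding unit_orbit_def by blast
  moreover have "x \<in> carrier G"
    using s t by simp
  ultimately show ?thesis
    using unit_orbit_subset s x by blast
qed

text \<open>Since raising to the power \<open>t\<close> is injective on the carrier,
  \<open>s [^] t\<close> has the same multiplicity in \<open>dilate G t J\<close> as
  \<open>s\<close> has in \<open>J\<close>.\<close>

lemma count_unit_orbit:
  assumes J: "set_mset J \<subseteq> carrier G" and fixed: "\<And>t. t \<in> K \<Longrightarrow> dilate G t J = J"
    and s: "s \<in> carrier G" and x: "x \<in> unit_orbit G s K"
  shows "count J x = count J s"
proof -
  obtain t where t: "t \<in> K" "x = s [^] t"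
    using x unfolding unit_orbit_def by auto
  obtain u :: int where u: "\<forall>s\<in>carrier G. (s [^] t) [^] u = s"
    using Zmod_units_inverse[OF t(1)] by blast
  have "count J x = count (image_mset (\<lambda>y. y [^] t) J) (s [^] t)"
    using fixed[OF t(1)] unfolding t(2) dilate_def by metis
  also have "\<dots> = sum (count J) {y. y \<in># J \<and> s [^] t = y [^] t}"
    by (subst count_image_mset') simp
  \<comment> \<open>Applying the inverse exponent \<open>u\<close> shows that the fibre over
    \<open>s [^] t\<close> contains at most \<open>s\<close>.\<close>
  also have "{y. y \<in># J \<and> s [^] t = y [^] t} = {y. y \<in># J \<and> y = s}"
    using s J by (intro Collect_cong conj_cong refl) (metis u subsetD)
  also have "sum (count J) \<dots> = count J s"
    by (cases "s \<in># J") (auto simp: not_in_iff conj_commute cong: conj_cong)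
  finally show ?thesis .
qed

lemma orbit_decomposition:
  assumes J: "set_mset J \<subseteq> carrier G" and fixed: "\<And>t. t \<in> K \<Longrightarrow> dilate G t J = J"
  shows "\<exists>(m::nat) (s :: nat \<Rightarrow> 'a) (\<alpha> :: nat \<Rightarrow> nat).
           (\<forall>i\<in>{1..m}. s i \<in> carrier G) \<and>
           disjoint_family_on (\<lambda>i. unit_orbit G (s i) K) {1..m} \<and>
           J = (\<Sum>i\<in>{1..m}. repeat_mset (\<alpha> i) (mset_set (unit_orbit G (s i) K)))"
proof -
  let ?O = "\<lambda>s. unit_orbit G s K"
  define m where "m = card (?O ` carrier G)"
  \<comment> \<open>Distinct orbits are enumerated without repetition; \<open>s\<close> then picks a
    representative of each.\<close>
  obtain f where f: "bij_betw f {1..m} (?O ` carrier G)"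
    using ex_bij_betw_nat_finite_1[of "?O ` carrier G"] fin unfolding m_def by auto
  have "\<forall>i\<in>{1..m}. \<exists>s. s \<in> carrier G \<and> ?O s = f i"
    using bij_betwE[OF f] by fastforce
  then obtain s where s: "\<And>i. i \<in> {1..m} \<Longrightarrow> s i \<in> carrier G"
      "\<And>i. i \<in> {1..m} \<Longrightarrow> ?O (s i) = f i"
    by metis
  have same: "i = j" if "i \<in> {1..m}" "j \<in> {1..m}" "x \<in> ?O (s i)" "x \<in> ?O (s j)" for i j x
  proof -
    have "f i = f j"
      using that s unit_orbit_eq by metis
    then show ?thesis
      using inj_onD[OF bij_betw_imp_inj_on[OF f]] that by blast
  qed
  have finO: "finite (?O (s i))" if "i \<in> {1..m}" for i
    using finite_subset[OF unit_orbit_carrier fin] s(1) that by blast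
  \<comment> \<open>The coefficient \<alpha> of an orbit is the multiplicity in \<open>J\<close> of
    its representative.\<close>
  have "J = (\<Sum>i\<in>{1..m}. repeat_mset (count J (s i)) (mset_set (?O (s i))))"
  proof (rule multiset_eqI)
    fix x
    have rhs: "count (\<Sum>i\<in>{1..m}. repeat_mset (count J (s i)) (mset_set (?O (s i)))) x
        = (\<Sum>i\<in>{1..m}. if x \<in> ?O (s i) then count J (s i) else 0)"
      unfolding count_sum by (intro sum.cong) (auto simp: count_mset_set' finO)
    show "count J x = count (\<Sum>i\<in>{1..m}. repeat_mset (count J (s i)) (mset_set (?O (s i)))) x"
    proof (cases "x \<in> carrier G")
      case True
      \<comment> \<open>The orbit of \<open>x\<close> appears as number \<open>j\<close>; by
        \<open>same\<close>, no other summand contributes at \<open>x\<close>.\<close>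
      then obtain j where j: "j \<in> {1..m}" "f j = ?O x"
        using f by (metis bij_betw_imp_surj_on imageE imageI)
      then have x: "x \<in> ?O (s j)"
        using s(2) unit_orbit_self[OF True] by simp
      have "(\<Sum>i\<in>{1..m}. if x \<in> ?O (s i) then count J (s i) else 0)
          = (\<Sum>i\<in>{1..m}. if i = j then count J (s j) else 0)"
      proof (intro sum.cong refl)
        fix i assume "i \<in> {1..m}"
        then have "x \<in> ?O (s i) \<longleftrightarrow> i = j"
          using same[OF _ j(1) _ x] x by blast
        then show "(if x \<in> ?O (s i) then count J (s i) else 0)
            = (if i = j then count J (s j) else 0)"
          by simp
      qed
      also have "\<dots> = count J x"
        using count_unit_orbit[OF J fixed s(1)[OF j(1)] x] j(1) by simp
      finally show ?thesis
        using rhs by simp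
    next
      case False
      \<comment> \<open>Outside the carrier both sides vanish, as all orbits lie inside it.\<close>
      then have "count J x = 0"
        using J by (auto simp: count_eq_zero_iff)
      moreover have "x \<notin> ?O (s i)" if "i \<in> {1..m}" for i
        using False unit_orbit_carrier s(1)[OF that] by blast
      ultimately show ?thesis
        unfolding rhs by simp
    qed
  qed
  moreover have "disjoint_family_on (\<lambda>i. ?O (s i)) {1..m}"
    unfolding disjoint_family_on_def using same by blast
  ultimately show ?thesis
    using s(1)
    by (intro exI[of _ m] exI[of _ s] exI[of _ "\<lambda>i. count J (s i)"]) blast
qed

end

end

theorem theorem8:
  fixes G :: "('a, 'b) monoid_scheme" (structure)
    and r :: nat and l :: "nat \<Rightarrow> nat"
    and I :: "'a multiset" and K :: "int set"
  assumes "comm_group G" and "finite (carrier G)"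
    and "\<forall>i\<in>{1..r}. 0 < l i"
    and "G \<cong> product_group {1..r} (\<lambda>i. integer_mod_group (l i))"
    and "set_mset I \<subseteq> carrier G"
    and "subgroup K (Zmod_units (group_exponent G))"
    and "K \<subseteq> multipliers G I"
    and "gcd (size I) (group_exponent G) = 1"
  shows "\<exists>(m::nat) (s :: nat \<Rightarrow> 'a) (\<alpha> :: nat \<Rightarrow> nat).
           (\<forall>i\<in>{1..m}. s i \<in> carrier G) \<and>
           disjoint_family_on (\<lambda>i. unit_orbit G (s i) K) {1..m} \<and>
           translate G I
             (inv (mset_sum G I [^] (size I ^ (totient (group_exponent G) - 1)))) =
           (\<Sum>i\<in>{1..m}. repeat_mset (\<alpha> i) (mset_set (unit_orbit G (s i) K)))"
proof -
  interpret comm_group G by fact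
  note fin = assms(2) and I = assms(5)
  define g where "g = inv (mset_sum G I [^] (size I ^ (totient (group_exponent G) - 1)))"
  have g: "g \<in> carrier G"
    unfolding g_def by simp
  have cop: "coprime (size I) (group_exponent G)"
    using assms(8) by (simp only: coprime_iff_gcd_eq_1)
  have sum0: "mset_sum G (translate G I g) = \<one>"
    unfolding g_def using mset_sum_centered[OF fin I cop] .
  have J: "set_mset (translate G I g) \<subseteq> carrier G"
    using I g by (rule set_mset_translate)
  have "dilate G t (translate G I g) = translate G I g" if t: "t \<in> K" for t
  proof -
    obtain h where h: "h \<in> carrier G" "dilate G t I = translate G I h"
      using subsetD[OF assms(7) t] unfolding multipliers_def by blast
    show ?thesis
      \<comment> \<open>Translation preserves the size, so the coprimality assumption passes from
        \<open>I\<close> to its translate.\<close>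
      by (rule dilate_eq_translate_imp_fixed[OF fin J _ sum0 _
            dilate_translate_eq_translate[OF I g h]])
        (use cop g h in \<open>simp_all add: translate_def\<close>)
  qed
  from orbit_decomposition[OF fin assms(6) J this] show ?thesis
    unfolding g_def .
qed

end
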